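(* Consider either the conservative linear scalar transport equation $u_t+(c(x,t)u)_x=0$, with $f(u;x,t)=c(x,t)u$ and $a=c(x,t)$, or the nonlinear Burgers equation $u_t+(\tfrac12u^2)_x=0$, with $f(u)=\tfrac12u^2$ and $a=\tfrac12u$. At a cell interface, let the scalar Steger-Warming numerical flux be $$\hat f^{SW}(u^L,u^R)=\frac12\Big(f(u^R)+f(u^L)-\big(|a^R|\,u^R-|a^L|\,u^L\big)\Big).$$ When $f(u;x,t)$ is a Lipschitz continuous function of $u$, the Steger-Warming numerical flux $\hat f^{SW}(u^L,u^R)$ is Lipschitz continuous with respect to both $u^L$ and $u^R$.
   Context: Here $u^L$ and $u^R$ are the left and right states of $u$ at the cell interface, and $a^L$, $a^R$ denote the values of $a=a(x,t,u)$ at that interface with $u=u^L$ and $u=u^R$ respectively. The function $a$ has the form $a=K f'(u)$ with a constant $K$ chosen so that $f(u)=a\,u$ ($K=1$ for the linear transport equation, $K=\tfrac12$ for the Burgers equation). In the linear case $a^L=a^R=c$ evaluated at the interface, independent of $u$. *)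

theory Defs
  imports "HOL-Analysis.Analysis"
begin

text \<open>
  Fluxes and speeds take their arguments in the order \<open>u x t\<close>, following \<open>f(u; x, t)\<close>;
  here \<open>(x, t)\<close> is the position of the cell interface and the time.
\<close>

definition transport_flux :: "(real \<Rightarrow> real \<Rightarrow> real) \<Rightarrow> real \<Rightarrow> real \<Rightarrow> real \<Rightarrow> real" where
  "transport_flux c u x t = c x t * u"

definition transport_speed :: "(real \<Rightarrow> real \<Rightarrow> real) \<Rightarrow> real \<Rightarrow> real \<Rightarrow> real \<Rightarrow> real" where
  "transport_speed c u x t = c x t"

text \<open>
  The Burgers flux is Lipschitz in \<open>u\<close> on bounded sets of states but not on the whole line, so
  Lipschitz continuity of a flux is always considered relative to a set of states.
\<close>

definition burgers_flux :: "real \<Rightarrow> real \<Rightarrow> real \<Rightarrow> real" where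
  "burgers_flux u x t = 1 / 2 * u\<^sup>2"

definition burgers_speed :: "real \<Rightarrow> real \<Rightarrow> real \<Rightarrow> real" where
  "burgers_speed u x t = 1 / 2 * u"

definition steger_warming_flux ::
  "(real \<Rightarrow> real \<Rightarrow> real \<Rightarrow> real) \<Rightarrow> (real \<Rightarrow> real \<Rightarrow> real \<Rightarrow> real) \<Rightarrow>
   real \<Rightarrow> real \<Rightarrow> real \<Rightarrow> real \<Rightarrow> real" where
  "steger_warming_flux f a x t uL uR =
     1 / 2 * (f uR x t + f uL x t - (\<bar>a uR x t\<bar> * uR - \<bar>a uL x t\<bar> * uL))"

text \<open>
  The speeds have the form \<open>a = K f'(u)\<close> with \<open>f(u) = a u\<close>, where \<open>K = 1\<close> for transport and
  \<open>K = 1/2\<close> for Burgers.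
\<close>

lemma transport_speed_eq_deriv:
  "transport_speed c u x t = 1 * deriv (\<lambda>v. transport_flux c v x t) u"
proof -
  have "((\<lambda>v. transport_flux c v x t) has_field_derivative c x t) (at u)"
    unfolding transport_flux_def by (auto intro!: derivative_eq_intros)
  then show ?thesis
    by (simp add: DERIV_imp_deriv transport_speed_def)
qed

lemma burgers_speed_eq_deriv:
  "burgers_speed u x t = 1 / 2 * deriv (\<lambda>v. burgers_flux v x t) u"
proof -
  have "((\<lambda>v. burgers_flux v x t) has_field_derivative u) (at u)"
    unfolding burgers_flux_def by (auto intro!: derivative_eq_intros)
  then show ?thesis
    by (simp add: DERIV_imp_deriv burgers_speed_def)
qed

lemma transport_flux_eq_speed_mult:
  "transport_flux c u x t = transport_speed c u x t * u"
  by (simp add: transport_flux_def transport_speed_def)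

lemma burgers_flux_eq_speed_mult:
  "burgers_flux u x t = burgers_speed u x t * u"
  by (simp add: burgers_flux_def burgers_speed_def power2_eq_square)

end

theory Submission
  imports Defs
begin

text \<open>
  The numerical flux is a sum of a function of \<open>uL\<close> alone and a function of \<open>uR\<close> alone, both
  built from \<open>f\<close> and the upwind term \<open>\<bar>a\<bar> u\<close>, so it suffices to bound the Lipschitz constant of
  \<open>\<bar>a\<bar> u\<close> on \<open>S\<close>
  (\<open>steger_warming_flux_lipschitz\<close>). For transport this term is linear in \<open>u\<close>. For Burgers it is
  \<open>\<bar>u\<bar> u / 2\<close>, which is Lipschitz on bounded sets (\<open>abs_mult_self_lipschitz\<close>).

  The Lipschitz hypothesis on the Burgers flux forces \<open>S\<close> to be bounded
  (\<open>bounded_if_square_lipschitz\<close>): it says that \<open>\<bar>u + v\<bar>\<close> is bounded over distinct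
  \<open>u, v \<in> S\<close>, and any three numbers are determined by their pairwise sums.
\<close>

text \<open>
  On the line, a Lipschitz bound for the square does not control the two signs separately, since
  it says nothing about the pair \<open>u, - u\<close>. A third point of \<open>S\<close> removes this freedom through
  \<open>2 u = (u + v) + (u + w) - (v + w)\<close>; if there is none, \<open>S\<close> is finite.
\<close>

lemma bounded_if_square_lipschitz:
  fixes S :: "real set"
  assumes "L-lipschitz_on S (\<lambda>u. u\<^sup>2)"
  shows "bounded S"
proof (cases "finite S")
  case True
  then show ?thesis by (rule finite_imp_bounded)
next
  case False
  have pair: "\<bar>u + v\<bar> \<le> L" if "u \<in> S" "v \<in> S" "u \<noteq> v" for u v
  proof -
    have "\<bar>u + v\<bar> * \<bar>u - v\<bar> = dist (u\<^sup>2) (v\<^sup>2)"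
      by (simp add: dist_real_def power2_eq_square square_diff_square_factored abs_mult)
    also have "\<dots> \<le> L * \<bar>u - v\<bar>"
      using lipschitz_onD[OF assms that(1,2)] by (simp add: dist_real_def)
    finally show ?thesis using that(3) by simp
  qed
  have "norm u \<le> 3 * L / 2" if "u \<in> S" for u
  proof -
    have "infinite (S - {u})" using False by simp
    then obtain v where v: "v \<in> S" "v \<noteq> u"
      using infinite_imp_nonempty by blast
    have "infinite (S - {u, v})" using False by simp
    then obtain w where w: "w \<in> S" "w \<noteq> u" "w \<noteq> v"
      using infinite_imp_nonempty by blast
    show ?thesis
      using pair[of u v] pair[of u w] pair[of v w] that v w by auto
  qed
  then show ?thesis unfolding bounded_iff by blast
qed

lemma abs_mult_self_lipschitz:
  fixes S :: "real set"
  assumes "bounded S"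
  obtains C where "C-lipschitz_on S (\<lambda>u. \<bar>u\<bar> * u)"
proof -
  obtain M where M: "0 < M" "\<And>u. u \<in> S \<Longrightarrow> \<bar>u\<bar> \<le> M"
    using assms unfolding bounded_pos by auto
  have "(2 * M)-lipschitz_on S (\<lambda>u. \<bar>u\<bar> * u)"
  proof (rule lipschitz_onI)
    fix u v assume uv: "u \<in> S" "v \<in> S"
    have "\<bar>\<bar>u\<bar> * u - \<bar>v\<bar> * v\<bar> = \<bar>\<bar>u\<bar> * (u - v) + (\<bar>u\<bar> - \<bar>v\<bar>) * v\<bar>"
      by (simp add: algebra_simps)
    also have "\<dots> \<le> \<bar>u\<bar> * \<bar>u - v\<bar> + \<bar>\<bar>u\<bar> - \<bar>v\<bar>\<bar> * \<bar>v\<bar>"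
      by (rule order_trans[OF abs_triangle_ineq]) (simp add: abs_mult)
    also have "\<dots> \<le> M * \<bar>u - v\<bar> + \<bar>u - v\<bar> * M"
      using M uv by (intro add_mono mult_mono) auto
    finally show "dist (\<bar>u\<bar> * u) (\<bar>v\<bar> * v) \<le> 2 * M * dist u v"
      by (simp add: dist_real_def algebra_simps)
  qed (use M in simp)
  then show thesis by (rule that)
qed

lemma lipschitz_on_section_left:
  assumes "C-lipschitz_on (A \<times> B) (\<lambda>(x, y). h x y)" "y \<in> B"
  shows "C-lipschitz_on A (\<lambda>x. h x y)"
proof (rule lipschitz_onI)
  fix u v assume "u \<in> A" "v \<in> A"
  then show "dist (h u y) (h v y) \<le> C * dist u v"
    using lipschitz_onD[OF assms(1), of "(u, y)" "(v, y)"] assms(2) by (simp add: dist_Pair_Pair)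
qed (rule lipschitz_on_nonneg[OF assms(1)])

lemma lipschitz_on_section_right:
  assumes "C-lipschitz_on (A \<times> B) (\<lambda>(x, y). h x y)" "x \<in> A"
  shows "C-lipschitz_on B (\<lambda>y. h x y)"
proof (rule lipschitz_onI)
  fix u v assume "u \<in> B" "v \<in> B"
  then show "dist (h x u) (h x v) \<le> C * dist u v"
    using lipschitz_onD[OF assms(1), of "(x, u)" "(x, v)"] assms(2) by (simp add: dist_Pair_Pair)
qed (rule lipschitz_on_nonneg[OF assms(1)])

lemma lipschitz_on_add_separate:
  fixes p :: "'a::metric_space \<Rightarrow> 'c::real_normed_vector" and q :: "'b::metric_space \<Rightarrow> 'c"
  assumes "C-lipschitz_on A p" "D-lipschitz_on B q"
  shows "(C + D)-lipschitz_on (A \<times> B) (\<lambda>(x, y). p x + q y)"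
proof -
  have "C-lipschitz_on (A \<times> B) (\<lambda>z. p (fst z))"
  proof (rule lipschitz_onI)
    fix z w assume "z \<in> A \<times> B" "w \<in> A \<times> B"
    then have "dist (p (fst z)) (p (fst w)) \<le> C * dist (fst z) (fst w)"
      by (intro lipschitz_onD[OF assms(1)]) auto
    also have "\<dots> \<le> C * dist z w"
      by (intro mult_left_mono dist_fst_le lipschitz_on_nonneg[OF assms(1)])
    finally show "dist (p (fst z)) (p (fst w)) \<le> C * dist z w" .
  qed (rule lipschitz_on_nonneg[OF assms(1)])
  moreover have "D-lipschitz_on (A \<times> B) (\<lambda>z. q (snd z))"
  proof (rule lipschitz_onI)
    fix z w assume "z \<in> A \<times> B" "w \<in> A \<times> B"
    then have "dist (q (snd z)) (q (snd w)) \<le> D * dist (snd z) (snd w)"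
      by (intro lipschitz_onD[OF assms(2)]) auto
    also have "\<dots> \<le> D * dist z w"
      by (intro mult_left_mono dist_snd_le lipschitz_on_nonneg[OF assms(2)])
    finally show "dist (q (snd z)) (q (snd w)) \<le> D * dist z w" .
  qed (rule lipschitz_on_nonneg[OF assms(2)])
  ultimately show ?thesis
    by (simp add: case_prod_unfold lipschitz_on_add)
qed

text \<open>
  The two split fluxes are \<open>(f + \<bar>a\<bar> u) / 2\<close>, taken at the left state, and \<open>(f - \<bar>a\<bar> u) / 2\<close>,
  taken at the right state; each inherits a Lipschitz constant from \<open>f\<close> and \<open>\<bar>a\<bar> u\<close>.
\<close>

lemma steger_warming_flux_lipschitz:
  assumes "L-lipschitz_on S (\<lambda>u. f u x t)"
    and "C-lipschitz_on S (\<lambda>u. \<bar>a u x t\<bar> * u)"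
  shows "(L + C)-lipschitz_on (S \<times> S) (\<lambda>(uL, uR). steger_warming_flux f a x t uL uR)"
proof -
  have "(1/2 * (L + C))-lipschitz_on S (\<lambda>u. 1/2 * (f u x t + \<bar>a u x t\<bar> * u))"
    using lipschitz_on_cmult_real[OF lipschitz_on_add[OF assms], of "1/2"] by simp
  moreover have "(1/2 * (L + C))-lipschitz_on S (\<lambda>u. 1/2 * (f u x t - \<bar>a u x t\<bar> * u))"
    using lipschitz_on_cmult_real[OF lipschitz_on_diff[OF assms], of "1/2"] by simp
  ultimately have "(1/2 * (L + C) + 1/2 * (L + C))-lipschitz_on (S \<times> S)
      (\<lambda>(uL, uR). 1/2 * (f uL x t + \<bar>a uL x t\<bar> * uL) + 1/2 * (f uR x t - \<bar>a uR x t\<bar> * uR))"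
    by (rule lipschitz_on_add_separate)
  moreover have "(\<lambda>(uL, uR). 1/2 * (f uL x t + \<bar>a uL x t\<bar> * uL)
        + 1/2 * (f uR x t - \<bar>a uR x t\<bar> * uR)) =
      (\<lambda>(uL, uR). steger_warming_flux f a x t uL uR)"
    by (auto simp: steger_warming_flux_def fun_eq_iff field_simps)
  moreover have "1/2 * (L + C) + 1/2 * (L + C) = L + C" by simp
  ultimately show ?thesis by simp
qed

theorem mainTheorem3:
  fixes f a :: "real \<Rightarrow> real \<Rightarrow> real \<Rightarrow> real"
    and x t :: real
    and S :: "real set"
  assumes "(\<exists>c :: real \<Rightarrow> real \<Rightarrow> real. f = transport_flux c \<and> a = transport_speed c) \<or>
           (f = burgers_flux \<and> a = burgers_speed)"
    and "\<exists>L. L-lipschitz_on S (\<lambda>u. f u x t)"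
  shows "\<exists>C. C-lipschitz_on (S \<times> S) (\<lambda>(uL, uR). steger_warming_flux f a x t uL uR) \<and>
             (\<forall>uR\<in>S. C-lipschitz_on S (\<lambda>uL. steger_warming_flux f a x t uL uR)) \<and>
             (\<forall>uL\<in>S. C-lipschitz_on S (\<lambda>uR. steger_warming_flux f a x t uL uR))"
proof -
  obtain L where L: "L-lipschitz_on S (\<lambda>u. f u x t)" using assms(2) by blast
  obtain C where C: "C-lipschitz_on S (\<lambda>u. \<bar>a u x t\<bar> * u)"
    using assms(1)
  proof (elim disjE exE conjE)
    fix c assume "a = transport_speed c"
    then have "(\<bar>c x t\<bar> * 1)-lipschitz_on S (\<lambda>u. \<bar>a u x t\<bar> * u)"
      using lipschitz_on_cmult_real[OF lipschitz_on_id, of "\<bar>c x t\<bar>" S]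
      by (simp add: transport_speed_def)
    then show thesis by (rule that)
  next
    assume burgers: "f = burgers_flux" "a = burgers_speed"
    have "(2 * L)-lipschitz_on S (\<lambda>u. u\<^sup>2)"
      using lipschitz_on_cmult_real[OF L, of 2] burgers by (simp add: burgers_flux_def)
    then obtain D where D: "D-lipschitz_on S (\<lambda>u. \<bar>u\<bar> * u)"
      using bounded_if_square_lipschitz abs_mult_self_lipschitz by blast
    have "(1/2 * D)-lipschitz_on S (\<lambda>u. \<bar>a u x t\<bar> * u)"
      using lipschitz_on_cmult_real[OF D, of "1/2"] burgers
      by (simp add: burgers_speed_def abs_mult)
    then show thesis by (rule that)
  qed
  have "(L + C)-lipschitz_on (S \<times> S) (\<lambda>(uL, uR). steger_warming_flux f a x t uL uR)"
    using L C by (rule steger_warming_flux_lipschitz)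
  then show ?thesis
    by (intro exI[of _ "L + C"] conjI ballI)
      (auto intro: lipschitz_on_section_left lipschitz_on_section_right)
qed

end
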